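(* Let $\{p_n\}_{n\ge0}$ be orthogonal polynomials with respect to the inner product $\langle f,g\rangle=\int_{\mathbb{R}}f(x)g(x)\,d\mu(x)$, with three-term recurrence relation $xp_n(x)=A_np_{n+1}(x)+B_np_n(x)+C_np_{n-1}(x)$. Let $L$ be a linear operator acting on the space $\mathbb{R}[x]$ of polynomials in one variable with real coefficients such that $L$ is skew symmetric with respect to this inner product, i.e. $\langle Lf,g\rangle=-\langle f,Lg\rangle$ for all $f,g\in\mathbb{R}[x]$, and such that for all $n\ge 0$ $$L(x^n)=\gamma_nx^{n+1}+\text{terms of lower degree},$$ where $\gamma_n\ne0$. Then for all $n\ge0$ the following structure relation and lowering and raising relations hold: $$(Lp_n)(x)=\gamma_nA_np_{n+1}(x)-\gamma_{n-1}C_np_{n-1}(x),$$ $$-\gamma_n(x-B_n)p_n(x)+(Lp_n)(x)=-(\gamma_n+\gamma_{n-1})C_np_{n-1}(x),$$ $$\gamma_{n-1}(x-B_n)p_n(x)+(Lp_n)(x)=(\gamma_n+\gamma_{n-1})A_np_{n+1}(x).$$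
   Context: $\mu$ is an orthogonality measure on $\mathbb{R}$ (a positive measure with infinite support and all moments finite), and $p_n\in\mathbb{R}[x]$ satisfy $p_n(x)=k_nx^n+\cdots$ with $k_n\ne0$ and $\langle p_n,p_m\rangle=h_n\delta_{n,m}$. Then $A_n=k_n/k_{n+1}$ and $C_n=A_{n-1}h_n/h_{n-1}$ ($n\ge1$). Conventions for $n=0$: $p_{-1}:=0$, the terms containing $p_{-1}$ are $0$, and $\gamma_{-1}$ may be any real number. *)

theory Defs
  imports "HOL-Analysis.Analysis" "HOL-Computational_Algebra.Polynomial"
begin

definition measure_support :: "'a::topological_space measure \<Rightarrow> 'a set" where
  "measure_support M = {x. \<forall>U. open U \<and> x \<in> U \<longrightarrow> emeasure M U > 0}"

definition orthogonality_measure :: "real measure \<Rightarrow> bool" where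
  "orthogonality_measure M \<longleftrightarrow>
     sets M = sets borel \<and>
     infinite (measure_support M) \<and>
     (\<forall>n::nat. integrable M (\<lambda>x. x ^ n))"

definition poly_inner :: "real measure \<Rightarrow> real poly \<Rightarrow> real poly \<Rightarrow> real" where
  "poly_inner M f g = (LINT x|M. poly f x * poly g x)"

(* The squared norms are h n = poly_inner M (p n) (p n) and the leading coefficients are
   k n = lead_coeff (p n); requiring p n to be nonzero excludes only p 0 = 0, where
   degree 0 = 0 would otherwise permit it. *)
definition orthogonal_polynomials :: "real measure \<Rightarrow> (nat \<Rightarrow> real poly) \<Rightarrow> bool" where
  "orthogonal_polynomials M p \<longleftrightarrow>
     (\<forall>n. degree (p n) = n \<and> p n \<noteq> 0) \<and>
     (\<forall>n m. n \<noteq> m \<longrightarrow> poly_inner M (p n) (p m) = 0)"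

definition skew_symmetric :: "real measure \<Rightarrow> (real poly \<Rightarrow> real poly) \<Rightarrow> bool" where
  "skew_symmetric M L \<longleftrightarrow> (\<forall>f g. poly_inner M (L f) g = - poly_inner M f (L g))"

(* prev a s n is the term of index n - 1 of the sequence s extended by the value a at index -1. *)
fun prev :: "'a \<Rightarrow> (nat \<Rightarrow> 'a) \<Rightarrow> nat \<Rightarrow> 'a" where
  "prev a s 0 = a"
| "prev a s (Suc n) = s n"

end

theory Submission
  imports Defs
begin

text \<open>
  Matching leading coefficients, \<open>L p\<^sub>n - \<gamma>\<^sub>n A\<^sub>n p\<^sub>n\<^sub>+\<^sub>1\<close> has degree at most \<open>n\<close>. By skew symmetry
  \<open>L p\<^sub>n\<close> is orthogonal to \<open>p\<^sub>n\<close> and, since \<open>L\<close> raises degrees by one, to \<open>p\<^sub>j\<close> for \<open>j < n - 1\<close>;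
  hence only the \<open>p\<^sub>n\<^sub>-\<^sub>1\<close> component remains, and it is computed from
  \<open>\<langle>L p\<^sub>n, p\<^sub>n\<^sub>-\<^sub>1\<rangle> = - \<langle>p\<^sub>n, L p\<^sub>n\<^sub>-\<^sub>1\<rangle> = - \<gamma>\<^sub>n\<^sub>-\<^sub>1 A\<^sub>n\<^sub>-\<^sub>1 h\<^sub>n\<close> and \<open>A\<^sub>n\<^sub>-\<^sub>1 h\<^sub>n = C\<^sub>n h\<^sub>n\<^sub>-\<^sub>1\<close>.
  The lowering and raising relations follow by eliminating \<open>p\<^sub>n\<^sub>+\<^sub>1\<close> or \<open>p\<^sub>n\<^sub>-\<^sub>1\<close> with the recurrence.
\<close>

lemma integrable_poly:
  assumes "orthogonality_measure M"
  shows "integrable M (poly f)"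
proof -
  have "integrable M (\<lambda>x. \<Sum>i\<le>degree f. coeff f i * x ^ i)"
    using assms unfolding orthogonality_measure_def by (intro Bochner_Integration.integrable_sum) auto
  then show ?thesis
    by (simp add: poly_altdef[abs_def])
qed

lemma integrable_poly_mult:
  assumes "orthogonality_measure M"
  shows "integrable M (\<lambda>x. poly f x * poly g x)"
  using integrable_poly[OF assms, of "f * g"] by (simp add: poly_mult[abs_def])

lemma poly_inner_commute: "poly_inner M f g = poly_inner M g f"
  by (simp add: poly_inner_def mult.commute)

lemma poly_inner_zero_right [simp]: "poly_inner M f 0 = 0"
  by (simp add: poly_inner_def)

lemma poly_inner_smult_right [simp]: "poly_inner M f (smult c g) = c * poly_inner M f g"
  by (simp add: poly_inner_def mult.left_commute)

lemma poly_inner_add_right: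
  assumes "orthogonality_measure M"
  shows "poly_inner M f (g + h) = poly_inner M f g + poly_inner M f h"
  by (simp add: poly_inner_def distrib_left integrable_poly_mult[OF assms])

lemma poly_inner_diff_right:
  assumes "orthogonality_measure M"
  shows "poly_inner M f (g - h) = poly_inner M f g - poly_inner M f h"
  by (simp add: poly_inner_def right_diff_distrib integrable_poly_mult[OF assms])

lemma poly_inner_mult_shift: "poly_inner M (q * f) g = poly_inner M f (q * g)"
  by (simp add: poly_inner_def ac_simps)

text \<open>If \<open>\<langle>f, f\<rangle> = 0\<close>, the complement of the zero set of \<open>f\<close> is an open null set, so the zeros
  contain the support.\<close>
lemma poly_inner_self_eq_0_iff:
  assumes M: "orthogonality_measure M"
  shows "poly_inner M f f = 0 \<longleftrightarrow> f = 0"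
proof
  assume "poly_inner M f f = 0"
  then have "AE x in M. poly f x * poly f x = 0"
    unfolding poly_inner_def
    by (subst (asm) integral_nonneg_eq_0_iff_AE) (auto intro: integrable_poly_mult[OF M])
  then have AE: "AE x in M. x \<notin> {x. poly f x \<noteq> 0}"
    by simp
  have opn: "open {x. poly f x \<noteq> 0}"
    by (intro open_Collect_neq continuous_intros)
  moreover have sets: "sets M = sets borel"
    using M by (simp add: orthogonality_measure_def)
  ultimately have "emeasure M {x. poly f x \<noteq> 0} = 0"
    using AE sets_eq_imp_space_eq[OF sets] by (subst (asm) AE_iff_measurable[OF _ refl]) auto
  with opn have "measure_support M \<subseteq> {x. poly f x = 0}"
    unfolding measure_support_def by fastforce
  with M have "infinite {x. poly f x = 0}"
    unfolding orthogonality_measure_def by (auto dest: finite_subset)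
  then show "f = 0"
    using poly_roots_finite by blast
qed simp

text \<open>Induction on \<open>n\<close>: subtracting the multiple of \<open>p n\<close> that
  cancels the coefficient of index \<open>n\<close> lowers the bound. Bounding coefficients instead
  of the degree lets \<open>n = 0\<close> mean \<open>f = 0\<close>, which
  \<open>degree f < n\<close> could not express.\<close>

lemma poly_inner_eq_0_if_orthogonal_to_basis:
  assumes M: "orthogonality_measure M"
    and p: "\<And>i. degree (p i) = i" "\<And>i. p i \<noteq> 0"
    and "\<And>i. i \<ge> n \<Longrightarrow> coeff f i = 0"
    and "\<And>j. j < n \<Longrightarrow> poly_inner M g (p j) = 0"
  shows "poly_inner M g f = 0"
  using assms(4,5)
proof (induction n arbitrary: f)
  case 0
  then have "f = 0"
    by (simp add: poly_eq_iff)
  then show ?case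
    by simp
next
  case (Suc n)
  let ?c = "coeff f n / coeff (p n) n"
  have lc: "coeff (p n) n \<noteq> 0"
    using p[of n] by (metis leading_coeff_0_iff)
  have "poly_inner M g (f - smult ?c (p n)) = 0"
  proof (rule Suc.IH)
    fix i assume "i \<ge> n"
    then show "coeff (f - smult ?c (p n)) i = 0"
      using lc Suc.prems(1)[of i] p(1)[of n] coeff_eq_0[of "p n" i] by (cases "i = n") auto
  qed (use Suc.prems(2) in auto)
  then show ?case
    using Suc.prems(2)[of n] by (simp add: poly_inner_diff_right[OF M])
qed

text \<open>In the monomial expansion of \<open>f\<close>, only \<open>monom 1 n\<close> can
  contribute to index \<open>Suc n\<close> of \<open>L f\<close>, and no monomial reaches beyond
  it.\<close>

lemma degree_raising_coeffs:
  assumes linear: "Vector_Spaces.linear smult smult L"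
    and leading: "\<And>n. \<exists>r. degree r < Suc n \<and> L (monom 1 n) = monom (\<gamma> n) (Suc n) + r"
    and f: "degree f \<le> n"
  shows "coeff (L f) (Suc n) = \<gamma> n * coeff f n"
    and "\<And>i. i > Suc n \<Longrightarrow> coeff (L f) i = 0"
proof -
  interpret Vector_Spaces.linear smult smult L
    by (rule linear)
  have mon: "coeff (L (monom 1 k)) i = (if i = Suc k then \<gamma> k else 0)" if "i > k" for i k
  proof -
    obtain r where "degree r < Suc k" "L (monom 1 k) = monom (\<gamma> k) (Suc k) + r"
      using leading by blast
    with that show ?thesis
      by (auto simp: coeff_eq_0)
  qed
  have "L f = L (\<Sum>k\<le>n. smult (coeff f k) (monom 1 k))"
    using poly_as_sum_of_monoms'[OF f] by (simp add: smult_monom)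
  also have "\<dots> = (\<Sum>k\<le>n. smult (coeff f k) (L (monom 1 k)))"
    by (simp only: sum scale)
  finally have *: "coeff (L f) i = (\<Sum>k\<le>n. coeff f k * coeff (L (monom 1 k)) i)" for i
    by (simp add: coeff_sum)
  have "coeff (L f) (Suc n) = (\<Sum>k\<le>n. if k = n then coeff f k * \<gamma> k else 0)"
    unfolding * by (intro sum.cong) (auto simp: mon)
  then show "coeff (L f) (Suc n) = \<gamma> n * coeff f n"
    by simp
  show "coeff (L f) i = 0" if "i > Suc n" for i
    unfolding * using that by (intro sum.neutral) (auto simp: mon)
qed

theorem proposition2p1:
  fixes M :: "real measure"
    and p :: "nat \<Rightarrow> real poly"
    and A B C :: "nat \<Rightarrow> real"
    and L :: "real poly \<Rightarrow> real poly"
    and \<gamma> :: "nat \<Rightarrow> real"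
    and \<gamma>m1 :: real
  assumes measure: "orthogonality_measure M"
    and orthogonal: "orthogonal_polynomials M p"
    and recurrence: "\<And>n x. x * poly (p n) x =
          A n * poly (p (Suc n)) x + B n * poly (p n) x + C n * poly (prev 0 p n) x"
    and linear: "Vector_Spaces.linear smult smult L"
    and skew: "skew_symmetric M L"
    and leading: "\<And>n. \<exists>r. degree r < Suc n \<and> L (monom 1 n) = monom (\<gamma> n) (Suc n) + r"
    and nonzero: "\<And>n. \<gamma> n \<noteq> 0"
  shows "\<forall>n x.
     poly (L (p n)) x
       = \<gamma> n * A n * poly (p (Suc n)) x - prev \<gamma>m1 \<gamma> n * C n * poly (prev 0 p n) x \<and>
     - \<gamma> n * (x - B n) * poly (p n) x + poly (L (p n)) x
       = - (\<gamma> n + prev \<gamma>m1 \<gamma> n) * C n * poly (prev 0 p n) x \<and>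
     prev \<gamma>m1 \<gamma> n * (x - B n) * poly (p n) x + poly (L (p n)) x
       = (\<gamma> n + prev \<gamma>m1 \<gamma> n) * A n * poly (p (Suc n)) x"
proof -
  have deg: "degree (p n) = n" and p0: "p n \<noteq> 0" for n
    using orthogonal by (auto simp: orthogonal_polynomials_def)
  have orth: "poly_inner M (p n) (p m) = 0" if "n \<noteq> m" for n m
    using orthogonal that by (auto simp: orthogonal_polynomials_def)
  have skewD: "poly_inner M (L f) g = - poly_inner M f (L g)" for f g
    using skew by (simp add: skew_symmetric_def)
  note inner_simps = poly_inner_add_right[OF measure] poly_inner_diff_right[OF measure]
  note basis = poly_inner_eq_0_if_orthogonal_to_basis[OF measure deg p0]
  note Lcoeff = degree_raising_coeffs[OF linear leading]
  have rec: "[:0, 1:] * p n = smult (A n) (p (Suc n)) + smult (B n) (p n) + smult (C n) (prev 0 p n)" for n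
    by (rule poly_ext) (use recurrence in simp)
  have deg_prev: "coeff (prev 0 p n) i = 0" if "i \<ge> n" for n i
    using that by (cases n) (auto simp: coeff_eq_0 deg)
  have low: "poly_inner M (p n) f = 0" if "\<And>i. i \<ge> n \<Longrightarrow> coeff f i = 0" for n f
    using that by (rule basis) (auto intro: orth)
  \<comment> \<open>Comparing coefficients at \<open>Suc n\<close> in the recurrence recovers the
    formula for \<open>A n\<close> as a ratio of leading coefficients.\<close>
  have lead: "coeff (p n) n = A n * coeff (p (Suc n)) (Suc n)" for n
  proof -
    have "coeff ([:0, 1:] * p n) (Suc n) = coeff (p n) n"
      by simp
    then show ?thesis
      unfolding rec by (simp add: deg coeff_eq_0 deg_prev)
  qed
  have coeff_L: "coeff (L (p n) - smult (\<gamma> n * A n) (p (Suc n))) i = 0" if "i \<ge> Suc n" for n i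
  proof (cases "i = Suc n")
    case True
    then show ?thesis
      using Lcoeff(1)[of "p n" n] lead[of n] by (simp add: deg)
  next
    case False
    with that show ?thesis
      using Lcoeff(2)[of "p n" n i] by (simp add: deg coeff_eq_0)
  qed
  have inner_L: "poly_inner M (p (Suc n)) (L (p n)) = \<gamma> n * A n * poly_inner M (p (Suc n)) (p (Suc n))" for n
    using low[of "Suc n", OF coeff_L[of n]] by (simp add: inner_simps)
  \<comment> \<open>Both sides equal the inner product of x * \<open>p n\<close> with
    \<open>p (Suc n)\<close>: expand the product by the recurrence at \<open>n\<close>, or move x
    across and use the recurrence at \<open>Suc n\<close>.\<close>
  have AC: "A n * poly_inner M (p (Suc n)) (p (Suc n)) = C (Suc n) * poly_inner M (p n) (p n)" for n
  proof -
    have "poly_inner M (p (Suc n)) ([:0, 1:] * p n) = poly_inner M (p n) ([:0, 1:] * p (Suc n))"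
      by (metis poly_inner_mult_shift poly_inner_commute)
    moreover have "poly_inner M (p (Suc n)) (prev 0 p n) = 0"
      by (rule low) (simp add: deg_prev)
    ultimately show ?thesis
      unfolding rec by (simp add: inner_simps orth)
  qed
  have L_p: "L (p n) = smult (\<gamma> n * A n) (p (Suc n)) - smult (prev \<gamma>m1 \<gamma> n * C n) (prev 0 p n)" for n
  proof -
    \<comment> \<open>\<open>D\<close> is the defect of the structure relation. It lies in the span
      of \<open>p 0\<close>, ..., \<open>p n\<close> and is shown orthogonal to each of them, hence
      to itself. For \<open>n = 0\<close> the value \<open>\<gamma>m1\<close> is harmless, as it
      multiplies \<open>prev 0 p 0 = 0\<close>.\<close>
    define D where
      "D = L (p n) - smult (\<gamma> n * A n) (p (Suc n)) + smult (prev \<gamma>m1 \<gamma> n * C n) (prev 0 p n)"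
    have coeff_D: "coeff D i = 0" if "i \<ge> Suc n" for i
      using coeff_L[OF that] that by (simp add: D_def deg_prev)
    have "poly_inner M D (p j) = 0" if "j < Suc n" for j
    proof -
      have D: "poly_inner M D (p j) =
          - poly_inner M (p n) (L (p j)) + prev \<gamma>m1 \<gamma> n * C n * poly_inner M (p j) (prev 0 p n)"
        using that orth[of j "Suc n"] skewD[of "p n" "p j"]
        by (simp add: D_def inner_simps poly_inner_commute[of M _ "p j"])
      consider "j = n" | "n = Suc j" | "Suc j < n"
        using \<open>j < Suc n\<close> by linarith
      then show ?thesis
      proof cases
        case 1
        \<comment> \<open>By skew symmetry and the symmetry of the inner product, this number equals
          its own negative.\<close>
        have "poly_inner M (p n) (L (p n)) = 0"
          using skewD[of "p n" "p n"] by (simp add: poly_inner_commute)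
        moreover have "poly_inner M (p n) (prev 0 p n) = 0"
          by (rule low) (simp add: deg_prev)
        ultimately show ?thesis
          using D 1 by simp
      next
        case 2
        \<comment> \<open>Here \<open>prev\<close> evaluates to index \<open>j\<close>, and the two
          terms of \<open>D\<close> cancel by \<open>AC\<close>.\<close>
        then show ?thesis
          using D AC[of j] by (simp add: inner_L)
      next
        case 3
        have "poly_inner M (p n) (L (p j)) = 0"
          by (rule low) (use 3 Lcoeff(2)[of "p j" j] in \<open>simp add: deg\<close>)
        moreover have "poly_inner M (p j) (prev 0 p n) = 0"
          using 3 by (cases n) (auto simp: orth)
        ultimately show ?thesis
          using D by simp
      qed
    qed
    with coeff_D have "poly_inner M D D = 0"
      by (rule basis)
    then have "D = 0"
      by (simp add: poly_inner_self_eq_0_iff[OF measure])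
    then show ?thesis
      by (simp add: D_def algebra_simps add_eq_0_iff)
  qed
  show ?thesis
  proof (intro allI)
    fix n x
    have struct: "poly (L (p n)) x
       = \<gamma> n * A n * poly (p (Suc n)) x - prev \<gamma>m1 \<gamma> n * C n * poly (prev 0 p n) x"
      by (simp add: L_p)
    \<comment> \<open>Used with \<open>c\<close> equal to \<open>- \<gamma> n\<close> for lowering
      and to \<open>prev \<gamma>m1 \<gamma> n\<close> for raising; each choice cancels one of the
      two neighbours in \<open>struct\<close>.\<close>
    have xB: "c * (x - B n) * poly (p n) x
        = c * (A n * poly (p (Suc n)) x + C n * poly (prev 0 p n) x)" for c
      using recurrence[of x n] by (simp add: algebra_simps)
    show "poly (L (p n)) x
       = \<gamma> n * A n * poly (p (Suc n)) x - prev \<gamma>m1 \<gamma> n * C n * poly (prev 0 p n) x \<and>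
     - \<gamma> n * (x - B n) * poly (p n) x + poly (L (p n)) x
       = - (\<gamma> n + prev \<gamma>m1 \<gamma> n) * C n * poly (prev 0 p n) x \<and>
     prev \<gamma>m1 \<gamma> n * (x - B n) * poly (p n) x + poly (L (p n)) x
       = (\<gamma> n + prev \<gamma>m1 \<gamma> n) * A n * poly (p (Suc n)) x"
      unfolding xB struct by (simp add: algebra_simps)
  qed
qed

end
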